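(* Let $G$ be a finite, simple, undirected, connected graph with $\mathrm{fes}(G) \geq 2$. Then $\mathrm{MEG}(G) \leq 9\,\mathrm{fes}(G) + |L(G)| - 8$, where $L(G)$ is the set of leaves (vertices of degree $1$) of $G$.
   Context: Two vertices $x,y$ of $G$ monitor an edge $e$ if $e$ belongs to all shortest paths between $x$ and $y$. A set $S\subseteq V(G)$ is a monitoring edge-geodetic set (MEG-set) if for every edge $e$ of $G$ there is a pair $x,y\in S$ that monitors $e$. $\mathrm{MEG}(G)$ denotes the minimum size of an MEG-set of $G$. A feedback edge set of $G$ is a set of edges whose removal leaves a forest; $\mathrm{fes}(G)$ is the minimum size of a feedback edge set of $G$. *)

theory Defs
  imports Main
begin

definition simple_graph :: "'a set \<Rightarrow> 'a set set \<Rightarrow> bool" where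
  "simple_graph V E \<longleftrightarrow> finite V \<and> (\<forall>e\<in>E. e \<subseteq> V \<and> card e = 2)"

fun walk_edges :: "'a list \<Rightarrow> 'a set list" where
  "walk_edges [] = []"
| "walk_edges [v] = []"
| "walk_edges (u # v # p) = {u, v} # walk_edges (v # p)"

definition graph_walk :: "'a set \<Rightarrow> 'a set set \<Rightarrow> 'a list \<Rightarrow> bool" where
  "graph_walk V E p \<longleftrightarrow> p \<noteq> [] \<and> set p \<subseteq> V \<and> set (walk_edges p) \<subseteq> E"

definition path_between :: "'a set \<Rightarrow> 'a set set \<Rightarrow> 'a \<Rightarrow> 'a list \<Rightarrow> 'a \<Rightarrow> bool" where
  "path_between V E x p y \<longleftrightarrow> graph_walk V E p \<and> distinct p \<and> hd p = x \<and> last p = y"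

definition connected_graph :: "'a set \<Rightarrow> 'a set set \<Rightarrow> bool" where
  "connected_graph V E \<longleftrightarrow> V \<noteq> {} \<and> (\<forall>x\<in>V. \<forall>y\<in>V. \<exists>p. path_between V E x p y)"

definition graph_degree :: "'a set set \<Rightarrow> 'a \<Rightarrow> nat" where
  "graph_degree E v = card {e \<in> E. v \<in> e}"

definition leaves :: "'a set \<Rightarrow> 'a set set \<Rightarrow> 'a set" where
  "leaves V E = {v \<in> V. graph_degree E v = 1}"

text \<open>A cycle is given by the list of its distinct vertices in cyclic order, the first
  one not being repeated at the end.\<close>

definition graph_cycle :: "'a set \<Rightarrow> 'a set set \<Rightarrow> 'a list \<Rightarrow> bool" where
  "graph_cycle V E c \<longleftrightarrow>
     graph_walk V E c \<and> distinct c \<and> length c \<ge> 3 \<and> {last c, hd c} \<in> E"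

definition forest :: "'a set \<Rightarrow> 'a set set \<Rightarrow> bool" where
  "forest V E \<longleftrightarrow> (\<nexists>c. graph_cycle V E c)"

definition feedback_edge_set :: "'a set \<Rightarrow> 'a set set \<Rightarrow> 'a set set \<Rightarrow> bool" where
  "feedback_edge_set V E F \<longleftrightarrow> F \<subseteq> E \<and> forest V (E - F)"

definition fes :: "'a set \<Rightarrow> 'a set set \<Rightarrow> nat" where
  "fes V E = (LEAST k. \<exists>F. feedback_edge_set V E F \<and> card F = k)"

definition shortest_path :: "'a set \<Rightarrow> 'a set set \<Rightarrow> 'a \<Rightarrow> 'a list \<Rightarrow> 'a \<Rightarrow> bool" where
  "shortest_path V E x p y \<longleftrightarrow>
     path_between V E x p y \<and> (\<forall>q. path_between V E x q y \<longrightarrow> length p \<le> length q)"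

text \<open>The condition is vacuous if \<open>x\<close> and \<open>y\<close> lie in different components, so this is
  meant for connected graphs.  A vertex together with itself monitors no edge, the only
  shortest path being the one-vertex path.\<close>

definition monitors :: "'a set \<Rightarrow> 'a set set \<Rightarrow> 'a \<Rightarrow> 'a \<Rightarrow> 'a set \<Rightarrow> bool" where
  "monitors V E x y e \<longleftrightarrow> (\<forall>p. shortest_path V E x p y \<longrightarrow> e \<in> set (walk_edges p))"

definition MEG_set :: "'a set \<Rightarrow> 'a set set \<Rightarrow> 'a set \<Rightarrow> bool" where
  "MEG_set V E S \<longleftrightarrow> S \<subseteq> V \<and> (\<forall>e\<in>E. \<exists>x\<in>S. \<exists>y\<in>S. monitors V E x y e)"

definition MEG :: "'a set \<Rightarrow> 'a set set \<Rightarrow> nat" where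
  "MEG V E = (LEAST k. \<exists>S. MEG_set V E S \<and> card S = k)"

text \<open>Both minima range over nonempty collections, hence are attained.\<close>

lemma feedback_edge_set_all: "feedback_edge_set V E E"
proof -
  have "\<not> graph_cycle V {} c" for c :: "'a list"
    by (simp add: graph_cycle_def)
  then show ?thesis
    by (simp add: feedback_edge_set_def forest_def)
qed

lemma fes_attained: "\<exists>F. feedback_edge_set V E F \<and> card F = fes V E"
  unfolding fes_def by (rule LeastI_ex) (use feedback_edge_set_all in blast)

lemma MEG_set_all:
  assumes "simple_graph V E"
  shows "MEG_set V E V"
  unfolding MEG_set_def
proof (intro conjI ballI)
  fix e assume e: "e \<in> E"
  with assms have "e \<subseteq> V" "card e = 2"
    by (auto simp: simple_graph_def)
  then obtain x y where xy: "e = {x, y}" "x \<noteq> y" "x \<in> V" "y \<in> V"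
    by (auto simp: card_2_iff)
  have edge: "path_between V E x [x, y] y"
    using xy e by (auto simp: path_between_def graph_walk_def)
  have "e \<in> set (walk_edges p)" if p: "shortest_path V E x p y" for p
  proof -
    have "length p \<le> length [x, y]"
      using p edge unfolding shortest_path_def by blast
    moreover have "p \<noteq> []" "hd p = x" "last p = y"
      using p by (auto simp: shortest_path_def path_between_def graph_walk_def)
    ultimately have "p = [x, y]"
      using \<open>x \<noteq> y\<close> by (cases p rule: walk_edges.cases) (auto split: if_splits)
    then show ?thesis using xy by simp
  qed
  then have "monitors V E x y e"
    by (simp add: monitors_def)
  with xy show "\<exists>x\<in>V. \<exists>y\<in>V. monitors V E x y e" by blast
qed simp

lemma MEG_attained:
  assumes "simple_graph V E"
  shows "\<exists>S. MEG_set V E S \<and> card S = MEG V E"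
  unfolding MEG_def by (rule LeastI_ex) (use MEG_set_all[OF assms] in blast)

end

theory Submission
  imports Defs
begin

text \<open>
  Write \<open>r = |E| - |V| = fes - 1\<close>.  Deleting a leaf \<open>v\<close> with neighbour \<open>u\<close> preserves \<open>r\<close>, and an
  MEG-set of the smaller graph is turned into one of \<open>G\<close> by adding \<open>v\<close>, dropping \<open>u\<close> if \<open>u\<close> has become
  a leaf.  So let all degrees be at least \<open>2\<close>, let \<open>C\<close> be the set of vertices of degree at
  least \<open>3\<close>, and let \<open>d\<close> be the distance to \<open>C\<close>.  Every edge between different levels of \<open>d\<close> lies on a
  descending path from a local maximum \<open>m\<close> of \<open>d\<close> to \<open>C\<close>, which is a shortest path, and below \<open>m\<close> it
  never branches.  Hence \<open>m\<close> and its foot monitor the edge unless both descending paths from \<open>m\<close> have the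
  same foot; such an \<open>m\<close> is called a fork, and there it suffices to use the two neighbours of \<open>m\<close> as well.

  Counting the edges between consecutive levels from above and from below yields
  \<open>|tops| + |forks| \<le> (\<Sum>c\<in>C. deg c) = 2 r + 2 |C|\<close>, where the tops are the local maxima outside \<open>C\<close>.
  Moreover \<open>|C| \<le> 2 r\<close> and \<open>|forks| \<le> r + 1\<close>, so that
  \<open>|C| + |tops| + 2 |forks| \<le> 9 r + 1 = 9 fes - 8\<close>.
\<close>

section \<open>Cycles, connectivity and the feedback edge number\<close>

definition nbrs :: "'a set set \<Rightarrow> 'a \<Rightarrow> 'a set" where
  "nbrs E x = {y. {x, y} \<in> E}"

text \<open>Where only connectivity matters, reachability in \<open>(adj E)\<^sup>*\<close> replaces
  paths: detours can be concatenated without removing repeated vertices.\<close>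

definition adj :: "'a set set \<Rightarrow> ('a \<times> 'a) set" where
  "adj E = {(x, y). {x, y} \<in> E}"

lemma simple_graph_edgeD:
  assumes "simple_graph V E" "{x, y} \<in> E"
  shows "x \<noteq> y" "x \<in> V" "y \<in> V"
  using assms unfolding simple_graph_def by (metis card_2_iff doubleton_eq_iff insert_absorb2 insert_subset)+

lemma simple_graph_edgeE:
  assumes "simple_graph V E" "e \<in> E"
  obtains x y where "e = {x, y}" "x \<noteq> y" "x \<in> V" "y \<in> V"
  using assms unfolding simple_graph_def by (metis card_2_iff insert_subset)

lemma simple_graph_finite:
  assumes "simple_graph V E"
  shows "finite V" "finite E"
proof -
  show "finite V" using assms by (simp add: simple_graph_def)
  moreover have "E \<subseteq> Pow V" using assms by (auto simp: simple_graph_def)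
  ultimately show "finite E" by (meson finite_Pow_iff finite_subset)
qed

lemma simple_graph_mono: "simple_graph V E \<Longrightarrow> E' \<subseteq> E \<Longrightarrow> simple_graph V E'"
  by (auto simp: simple_graph_def)

lemma simple_graph_delete_vertex:
  "simple_graph V E \<Longrightarrow> simple_graph (V - {v}) {e \<in> E. v \<notin> e}"
  by (auto simp: simple_graph_def)

lemma nbrs_subset: "simple_graph V E \<Longrightarrow> nbrs E x \<subseteq> V"
  using simple_graph_edgeD by (fastforce simp: nbrs_def)

lemma finite_nbrs: "simple_graph V E \<Longrightarrow> finite (nbrs E x)"
  by (meson finite_subset nbrs_subset simple_graph_finite(1))

lemma graph_degree_eq_card_nbrs:
  assumes "simple_graph V E"
  shows "graph_degree E x = card (nbrs E x)"
proof -
  have "bij_betw (\<lambda>y. {x, y}) (nbrs E x) {e \<in> E. x \<in> e}"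
  proof (rule bij_betw_imageI)
    show "inj_on (\<lambda>y. {x, y}) (nbrs E x)"
      by (auto simp: inj_on_def doubleton_eq_iff)
    show "(\<lambda>y. {x, y}) ` nbrs E x = {e \<in> E. x \<in> e}"
    proof (intro equalityI subsetI)
      fix e assume e: "e \<in> {e \<in> E. x \<in> e}"
      then obtain a b where "e = {a, b}"
        using simple_graph_edgeE[OF assms, of e] by blast
      with e show "e \<in> (\<lambda>y. {x, y}) ` nbrs E x"
        by (auto simp: nbrs_def insert_commute)
    qed (auto simp: nbrs_def)
  qed
  then show ?thesis
    by (simp add: graph_degree_def bij_betw_same_card)
qed

lemma handshake:
  assumes "simple_graph V E"
  shows "(\<Sum>x\<in>V. graph_degree E x) = 2 * card E"
  unfolding graph_degree_def
proof (rule sum_multicount)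
  show "\<forall>e\<in>E. card {x \<in> V. x \<in> e} = 2"
  proof
    fix e assume "e \<in> E"
    with assms have "e \<subseteq> V" "card e = 2" by (auto simp: simple_graph_def)
    moreover from this have "{x \<in> V. x \<in> e} = e" by auto
    ultimately show "card {x \<in> V. x \<in> e} = 2" by simp
  qed
qed (use simple_graph_finite[OF assms] in auto)

lemma walk_edges_subset: "e \<in> set (walk_edges p) \<Longrightarrow> e \<subseteq> set p"
  by (induction p rule: walk_edges.induct) auto

lemma walk_edges_append_Cons:
  "walk_edges (xs @ y # zs) = walk_edges (xs @ [y]) @ walk_edges (y # zs)"
  by (induction xs rule: walk_edges.induct) auto

lemma walk_edges_rev: "walk_edges (rev p) = rev (walk_edges p)"
proof (induction p rule: walk_edges.induct)
  case (3 u v p)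
  have "walk_edges (rev (u # v # p)) = walk_edges (rev p @ v # [u])" by simp
  also have "\<dots> = walk_edges (rev (v # p)) @ [{v, u}]"
    by (subst walk_edges_append_Cons) simp
  finally show ?case using 3 by (simp add: insert_commute)
qed auto

lemma set_walk_edges_ConsD: "e \<in> set (walk_edges p) \<Longrightarrow> e \<in> set (walk_edges (x # p))"
  by (cases p) auto

lemma set_walk_edges_appendI: "e \<in> set (walk_edges p) \<Longrightarrow> e \<in> set (walk_edges (q @ p))"
  by (induction q) (auto intro: set_walk_edges_ConsD)

lemma graph_walk_Cons:
  "graph_walk V E (x # y # p) \<longleftrightarrow> x \<in> V \<and> {x, y} \<in> E \<and> graph_walk V E (y # p)"
  by (auto simp: graph_walk_def)

lemma adj_sym: "(x, y) \<in> adj E \<Longrightarrow> (y, x) \<in> adj E"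
  by (simp add: adj_def insert_commute)

lemma adj_rtrancl_sym: "(x, y) \<in> (adj E)\<^sup>* \<Longrightarrow> (y, x) \<in> (adj E)\<^sup>*"
  by (metis adj_sym sym_def sym_rtrancl)

lemma walk_adj_rtrancl:
  "p \<noteq> [] \<Longrightarrow> set (walk_edges p) \<subseteq> E \<Longrightarrow> (hd p, last p) \<in> (adj E)\<^sup>*"
proof (induction p rule: walk_edges.induct)
  case (3 u v p)
  then have "(u, v) \<in> adj E" "(v, last (v # p)) \<in> (adj E)\<^sup>*"
    by (auto simp: adj_def)
  then show ?case by (simp add: converse_rtrancl_into_rtrancl)
qed auto

lemma connected_graph_adj:
  "connected_graph V E \<Longrightarrow> x \<in> V \<Longrightarrow> y \<in> V \<Longrightarrow> (x, y) \<in> (adj E)\<^sup>*"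
  unfolding connected_graph_def path_between_def graph_walk_def
  using walk_adj_rtrancl by metis

text \<open>Only the deleted edges need a detour. This preserves connectivity when a cycle edge, or
  one edge at every fork, is removed.\<close>

lemma adj_rtrancl_bypass:
  assumes "\<And>x y. {x, y} \<in> E - E' \<Longrightarrow> (x, y) \<in> (adj E')\<^sup>*"
    and "(x, y) \<in> (adj E)\<^sup>*"
  shows "(x, y) \<in> (adj E')\<^sup>*"
proof -
  have "adj E \<subseteq> (adj E')\<^sup>*"
    using assms(1) by (auto simp: adj_def)
  then show ?thesis
    using assms(2) by (metis rtrancl_subset_rtrancl subsetD)
qed

section \<open>Edge counts of connected and of acyclic graphs\<close>

lemma connected_card_le:
  assumes "simple_graph V E" and "\<And>x y. x \<in> V \<Longrightarrow> y \<in> V \<Longrightarrow> (x, y) \<in> (adj E)\<^sup>*"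
  shows "card V \<le> card E + 1"
proof (cases "V = {}")
  case False
  note fin = simple_graph_finite[OF assms(1)]
  \<comment> \<open>Vertices are collected one at a time; each new one brings along an edge to an
    earlier one.\<close>
  have grow: "\<exists>A\<subseteq>V. card A = Suc n \<and> n \<le> card {e \<in> E. e \<subseteq> A}" if "Suc n \<le> card V" for n
    using that
  proof (induction n)
    case 0
    from False obtain v where "v \<in> V" by blast
    then show ?case by (intro exI[of _ "{v}"]) auto
  next
    case (Suc n)
    then obtain A where A: "A \<subseteq> V" "card A = Suc n" "n \<le> card {e \<in> E. e \<subseteq> A}" by auto
    then have finA: "finite A" using fin finite_subset by blast
    from A obtain a where a: "a \<in> A" by fastforce
    from A Suc.prems obtain b where b: "b \<in> V" "b \<notin> A"
      by (metis Suc_n_not_le_n subsetI subset_antisym)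
    \<comment> \<open>A set closed under \<open>adj E\<close> is closed under reachability, but
      \<open>b\<close> is reachable from \<open>a\<close>.\<close>
    have "\<not> adj E `` A \<subseteq> A"
    proof
      assume "adj E `` A \<subseteq> A"
      then have "(adj E)\<^sup>* `` A = A" by (rule Image_closed_trancl)
      with a b A(1) assms(2)[of a b] show False by blast
    qed
    then obtain x y where xy: "x \<in> A" "y \<notin> A" "{x, y} \<in> E"
      by (auto simp: adj_def)
    have "insert {x, y} {e \<in> E. e \<subseteq> A} \<subseteq> {e \<in> E. e \<subseteq> insert y A}" using xy by auto
    then have "card (insert {x, y} {e \<in> E. e \<subseteq> A}) \<le> card {e \<in> E. e \<subseteq> insert y A}"
      using fin by (intro card_mono) auto
    moreover have "card (insert {x, y} {e \<in> E. e \<subseteq> A}) = Suc (card {e \<in> E. e \<subseteq> A})"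
      using xy fin by (subst card_insert_disjoint) auto
    ultimately show ?case
      using A xy finA simple_graph_edgeD[OF assms(1) xy(3)]
      by (intro exI[of _ "insert y A"]) auto
  qed
  have "card V > 0" using False fin by auto
  then obtain n where n: "card V = Suc n" using not0_implies_Suc by blast
  then obtain A where "n \<le> card {e \<in> E. e \<subseteq> A}" using grow[of n] by auto
  also have "\<dots> \<le> card E" using fin by (intro card_mono) auto
  finally show ?thesis using n by simp
qed simp

text \<open>All neighbours of the first vertex \<open>x\<close> of a longest path lie on that path.
  One of them is not the successor of \<open>x\<close>, and its edge to \<open>x\<close> closes a
  cycle.\<close>

lemma cycle_if_min_degree_2:
  assumes "simple_graph V E" "V \<noteq> {}" "\<And>x. x \<in> V \<Longrightarrow> graph_degree E x \<ge> 2"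
  shows "\<exists>c. graph_cycle V E c"
proof -
  let ?P = "\<lambda>p. graph_walk V E p \<and> distinct p"
  obtain v where "v \<in> V" using assms by blast
  then have "?P [v]" by (simp add: graph_walk_def)
  moreover have "length p < Suc (card V)" if "?P p" for p
  proof -
    have "length p = card (set p)" using that by (simp add: distinct_card)
    also have "\<dots> \<le> card V"
      using that simple_graph_finite[OF assms(1)] by (intro card_mono) (auto simp: graph_walk_def)
    finally show ?thesis by simp
  qed
  ultimately obtain p where p: "?P p" and longest: "\<And>q. ?P q \<Longrightarrow> length q \<le> length p"
    using ex_has_greatest_nat[of ?P "[v]" length "Suc (card V)"] by auto
  then obtain x p' where xp: "p = x # p'" by (cases p) (auto simp: graph_walk_def)
  then have xV: "x \<in> V" using p by (auto simp: graph_walk_def)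
  have nb: "nbrs E x \<subseteq> set p'"
  proof
    fix y assume y: "y \<in> nbrs E x"
    then have e: "{y, x} \<in> E" by (simp add: nbrs_def insert_commute)
    have "y \<in> set p"
    proof (rule ccontr)
      assume "y \<notin> set p"
      then have "?P (y # p)"
        using p xp e simple_graph_edgeD[OF assms(1) e] by (simp add: graph_walk_Cons)
      then show False using longest by fastforce
    qed
    then show "y \<in> set p'" using xp simple_graph_edgeD[OF assms(1) e] by auto
  qed
  have two: "card (nbrs E x) \<ge> 2"
    using assms(3)[OF xV] graph_degree_eq_card_nbrs[OF assms(1)] by simp
  then obtain z p'' where zp: "p' = z # p''"
    using nb by (cases p') auto
  obtain y where y: "y \<in> nbrs E x" "y \<noteq> z"
  proof (rule ccontr)
    assume "\<not> thesis"
    with that have "nbrs E x \<subseteq> {z}" by blast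
    then have "card (nbrs E x) \<le> card {z}" by (intro card_mono) auto
    then show False using two by simp
  qed
  then have "y \<in> set p''" using nb zp by auto
  then obtain a b where ab: "p'' = a @ y # b" by (meson split_list)
  have "walk_edges p = walk_edges ((x # z # a) @ [y]) @ walk_edges (y # b)"
    using xp zp ab walk_edges_append_Cons[of "x # z # a" y b] by simp
  then have "graph_cycle V E (x # z # a @ [y])"
    using p y xp zp ab by (auto simp: graph_cycle_def graph_walk_def nbrs_def insert_commute)
  then show ?thesis by blast
qed

text \<open>Removing a vertex of degree at most 1 preserves \<open>card V \<le> card E\<close>; if
  there is none, the minimum degree is at least 2.\<close>

lemma cycle_if_card_edges_ge:
  assumes "simple_graph V E" "V \<noteq> {}" "card V \<le> card E"
  shows "\<exists>c. graph_cycle V E c"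
  using assms
proof (induction "card V" arbitrary: V E rule: less_induct)
  case less
  note fin = simple_graph_finite[OF less.prems(1)]
  show ?case
  proof (cases "\<forall>x\<in>V. graph_degree E x \<ge> 2")
    case True
    then show ?thesis using cycle_if_min_degree_2 less.prems by blast
  next
    case False
    then obtain v where v: "v \<in> V" "graph_degree E v \<le> 1" by force
    let ?E = "{e \<in> E. v \<notin> e}"
    have "E = ?E \<union> {e \<in> E. v \<in> e}" by blast
    then have "card E \<le> card ?E + graph_degree E v"
      unfolding graph_degree_def by (metis card_Un_le)
    then have E': "card (V - {v}) \<le> card ?E" using v less.prems fin by simp
    have ne: "V - {v} \<noteq> {}"
    proof
      assume "V - {v} = {}"
      then have V: "V = {v}" using v by blast
      have "E = {}"
      proof (rule ccontr)
        assume "E \<noteq> {}"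
        then obtain e where "e \<in> E" by blast
        then show False using simple_graph_edgeE[OF less.prems(1), of e] V
          by (metis singletonD)
      qed
      then show False using less.prems V by simp
    qed
    have "card (V - {v}) < card V" using v fin by (metis card_Diff1_less)
    then obtain c where "graph_cycle (V - {v}) ?E c"
      using less.hyps[OF _ simple_graph_delete_vertex[OF less.prems(1)] ne E'] by blast
    then have "graph_cycle V E c" by (auto simp: graph_cycle_def graph_walk_def)
    then show ?thesis by blast
  qed
qed

text \<open>For a minimum feedback edge set \<open>F\<close>, the forest \<open>E - F\<close> has
  fewer edges than vertices.\<close>

lemma card_edges_le_fes:
  assumes "simple_graph V E" "V \<noteq> {}"
  shows "card E + 1 \<le> card V + fes V E"
proof -
  obtain F where F: "feedback_edge_set V E F" "card F = fes V E" using fes_attained by blast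
  then have "card (E - F) < card V"
    using cycle_if_card_edges_ge[OF simple_graph_mono[OF assms(1)], of "E - F"] assms(2)
    by (meson Diff_subset feedback_edge_set_def forest_def not_le)
  moreover have "card E \<le> card (E - F) + card F"
  proof -
    have "E = (E - F) \<union> F" using F by (auto simp: feedback_edge_set_def)
    then show ?thesis by (metis card_Un_le)
  qed
  ultimately show ?thesis using F by simp
qed

text \<open>Cycle edges are deleted one by one. The rest of the cycle keeps the graph connected, so
  \<open>connected_card_le\<close> bounds the final forest from below and thereby the number of
  deletions from above.\<close>

lemma exists_small_feedback_edge_set:
  assumes "simple_graph V E" and "\<And>x y. x \<in> V \<Longrightarrow> y \<in> V \<Longrightarrow> (x, y) \<in> (adj E)\<^sup>*"
  shows "\<exists>F. feedback_edge_set V E F \<and> card F + card V \<le> card E + 1"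
  using assms
proof (induction "card E" arbitrary: E rule: less_induct)
  case less
  show ?case
  proof (cases "forest V E")
    case True
    then have "feedback_edge_set V E {}" by (simp add: feedback_edge_set_def)
    then show ?thesis using connected_card_le[OF less.prems] by fastforce
  next
    case False
    then obtain c where c: "graph_cycle V E c" by (auto simp: forest_def)
    define e where "e = {last c, hd c}"
    have e: "e \<in> E" using c by (simp add: graph_cycle_def e_def)
    have eE: "card (E - {e}) < card E" "card E = Suc (card (E - {e}))"
      using e simple_graph_finite[OF less.prems(1)]
      by (metis card_Diff1_less) (metis card_Suc_Diff1 e simple_graph_finite(2)[OF less.prems(1)])
    \<comment> \<open>A cycle has at least three vertices, so the list \<open>c\<close> itself does
      not traverse its closing edge and serves as a detour.\<close>
    have "e \<notin> set (walk_edges c)"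
    proof -
      obtain u v w where uvw: "c = u # v # w"
        using c by (cases c rule: walk_edges.cases) (auto simp: graph_cycle_def)
      then have uvw: "c = u # v # w" "w \<noteq> []" "distinct c"
        using c by (auto simp: graph_cycle_def)
      then have "u \<notin> set (v # w)" by auto
      then have "e \<notin> set (walk_edges (v # w))" using walk_edges_subset[of e "v # w"] uvw
        by (auto simp: e_def)
      moreover have "e \<noteq> {u, v}" using uvw by (auto simp: e_def doubleton_eq_iff)
      ultimately show ?thesis using uvw by simp
    qed
    then have "(hd c, last c) \<in> (adj (E - {e}))\<^sup>*"
      using c by (intro walk_adj_rtrancl) (auto simp: graph_cycle_def graph_walk_def)
    then have "(x, y) \<in> (adj (E - {e}))\<^sup>*" if "{x, y} \<in> E - (E - {e})" for x y
      using that by (auto simp: e_def doubleton_eq_iff dest: adj_rtrancl_sym)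
    then have "(x, y) \<in> (adj (E - {e}))\<^sup>*" if "x \<in> V" "y \<in> V" for x y
      using adj_rtrancl_bypass less.prems(2)[OF that] by metis
    then obtain F where F: "feedback_edge_set V (E - {e}) F" "card F + card V \<le> card (E - {e}) + 1"
      using less.hyps[OF eE(1) simple_graph_mono[OF less.prems(1)]] by blast
    have "E - insert e F = E - {e} - F" by blast
    then have "feedback_edge_set V E (insert e F)"
      using F e by (auto simp: feedback_edge_set_def)
    moreover have "card (insert e F) \<le> Suc (card F)" by (rule card_insert_le_m1) auto
    ultimately show ?thesis using F eE by fastforce
  qed
qed

text \<open>Together with \<open>card_edges_le_fes\<close> this gives |E| + 1 = |V| + fes for
  connected graphs.\<close>

lemma fes_le_card_edges:
  assumes "simple_graph V E" "connected_graph V E"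
  shows "fes V E + card V \<le> card E + 1"
proof -
  obtain F where "feedback_edge_set V E F" "card F + card V \<le> card E + 1"
    using exists_small_feedback_edge_set[OF assms(1)] connected_graph_adj[OF assms(2)] by blast
  moreover from this have "fes V E \<le> card F" unfolding fes_def by (intro Least_le) blast
  ultimately show ?thesis by simp
qed

section \<open>Pendant vertices\<close>

lemma path_between_rev: "path_between V E x p y \<Longrightarrow> path_between V E y (rev p) x"
  by (auto simp: path_between_def graph_walk_def walk_edges_rev hd_rev last_rev)

lemma shortest_path_rev: "shortest_path V E x p y \<Longrightarrow> shortest_path V E y (rev p) x"
  unfolding shortest_path_def by (metis length_rev path_between_rev)

lemma monitors_sym: "monitors V E x y e \<Longrightarrow> monitors V E y x e"
  unfolding monitors_def by (metis set_rev shortest_path_rev walk_edges_rev)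

lemma shortest_path_exists:
  assumes "connected_graph V E" "x \<in> V" "y \<in> V"
  shows "\<exists>p. shortest_path V E x p y"
proof -
  obtain p where "path_between V E x p y" using assms by (auto simp: connected_graph_def)
  then show ?thesis
    using ex_has_least_nat[of "\<lambda>p. path_between V E x p y" p length]
    by (auto simp: shortest_path_def)
qed

lemma monitors_neq:
  assumes "x \<in> V" "monitors V E x y e"
  shows "x \<noteq> y"
proof
  assume "x = y"
  then have "shortest_path V E x [x] y"
    using assms by (auto simp: shortest_path_def path_between_def graph_walk_def Suc_le_eq)
  then show False using assms by (fastforce simp: monitors_def)
qed

lemma monitors_edge:
  assumes "simple_graph V E" "{x, y} \<in> E"
  shows "monitors V E x y {x, y}"
  unfolding monitors_def
proof (intro allI impI)
  fix p assume p: "shortest_path V E x p y"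
  have "path_between V E x [x, y] y"
    using simple_graph_edgeD[OF assms] assms(2) by (auto simp: path_between_def graph_walk_def)
  then have "length p \<le> length [x, y]" using p unfolding shortest_path_def by blast
  then show "{x, y} \<in> set (walk_edges p)"
    using p simple_graph_edgeD(1)[OF assms]
    by (cases p rule: walk_edges.cases)
      (auto simp: shortest_path_def path_between_def graph_walk_def split: if_splits)
qed

text \<open>A vertex with a single neighbour is never interior to a path, so deleting it changes no
  distance and no shortest path between the other vertices.\<close>

lemma pendant_not_interior:
  assumes "nbrs E v = {u}" "path_between V E x p y" "x \<noteq> v" "y \<noteq> v"
  shows "v \<notin> set p"
proof
  assume "v \<in> set p"
  then obtain a b where ab: "p = a @ v # b" by (meson split_list)
  then have "a \<noteq> []" "b \<noteq> []" using assms by (auto simp: path_between_def)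
  then obtain a' w w' b' where w: "a = a' @ [w]" "b = w' # b'"
    by (metis list.exhaust rev_exhaust)
  have "set (walk_edges p) \<subseteq> E" using assms by (simp add: path_between_def graph_walk_def)
  then have "{w, v} \<in> E" "{v, w'} \<in> E"
    using ab w walk_edges_append_Cons[of a' w "v # w' # b'"] by auto
  then have "w \<in> nbrs E v" "w' \<in> nbrs E v" by (auto simp: nbrs_def insert_commute)
  then have "w = u" "w' = u" using assms(1) by auto
  then show False using assms(2) ab w by (auto simp: path_between_def)
qed

lemma path_between_delete_pendant:
  assumes "nbrs E v = {u}" "x \<noteq> v" "y \<noteq> v"
  shows "path_between (V - {v}) {e \<in> E. v \<notin> e} x p y \<longleftrightarrow> path_between V E x p y"
proof
  assume p: "path_between V E x p y"
  then have "v \<notin> set p" using pendant_not_interior assms by metis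
  then show "path_between (V - {v}) {e \<in> E. v \<notin> e} x p y"
    using p by (auto simp: path_between_def graph_walk_def dest: walk_edges_subset)
qed (auto simp: path_between_def graph_walk_def)

lemma connected_delete_pendant:
  assumes "nbrs E v = {u}" "connected_graph V E" "V \<noteq> {v}"
  shows "connected_graph (V - {v}) {e \<in> E. v \<notin> e}"
  using assms path_between_delete_pendant[OF assms(1)]
  by (auto simp: connected_graph_def)

lemma monitors_delete_pendant:
  assumes "nbrs E v = {u}" "x \<noteq> v" "y \<noteq> v"
  shows "monitors (V - {v}) {e \<in> E. v \<notin> e} x y e \<longleftrightarrow> monitors V E x y e"
  unfolding monitors_def shortest_path_def path_between_delete_pendant[OF assms] ..

lemma path_from_pendant:
  assumes "nbrs E v = {u}" "path_between V E v p y" "y \<noteq> v"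
  obtains q where "p = v # u # q" "path_between V E u (u # q) y"
proof -
  obtain w q where "p = v # w # q"
    using assms by (cases p rule: walk_edges.cases) (auto simp: path_between_def graph_walk_def)
  moreover from this have "w \<in> nbrs E v"
    using assms(2) by (auto simp: path_between_def graph_walk_def nbrs_def)
  ultimately show ?thesis
    using that assms by (auto simp: path_between_def graph_walk_def)
qed

lemma path_extend_pendant:
  assumes "simple_graph V E" "nbrs E v = {u}" "path_between V E u p y" "y \<noteq> v"
  shows "path_between V E v (v # p) y"
proof -
  have e: "{v, u} \<in> E" using assms(2) by (auto simp: nbrs_def)
  note e' = simple_graph_edgeD[OF assms(1) e]
  have "v \<notin> set p" using pendant_not_interior[OF assms(2,3)] e' assms(4) by auto
  then show ?thesis using assms(3) e e'
    by (cases p) (auto simp: path_between_def graph_walk_def)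
qed

text \<open>A shortest path from \<open>v\<close> is \<open>v\<close> followed by a shortest path
  from \<open>u\<close>, so \<open>v\<close> can take over the role of \<open>u\<close>.\<close>

lemma monitors_move_to_pendant:
  assumes "simple_graph V E" "nbrs E v = {u}" "monitors V E u y e" "y \<noteq> v"
  shows "monitors V E v y e"
  unfolding monitors_def
proof (intro allI impI)
  fix p assume p: "shortest_path V E v p y"
  then obtain q where q: "p = v # u # q" "path_between V E u (u # q) y"
    using path_from_pendant[OF assms(2) _ assms(4)] by (metis shortest_path_def)
  have "shortest_path V E u (u # q) y"
    unfolding shortest_path_def
  proof (intro conjI allI impI q(2))
    fix q' assume "path_between V E u q' y"
    then have "path_between V E v (v # q') y" using path_extend_pendant assms by metis
    then have "length p \<le> length (v # q')" using p unfolding shortest_path_def by blast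
    then show "length (u # q) \<le> length q'" using q by simp
  qed
  then have "e \<in> set (walk_edges (u # q))" using assms(3) by (auto simp: monitors_def)
  then show "e \<in> set (walk_edges p)" using q by simp
qed

lemma monitors_pendant_edge:
  assumes "nbrs E v = {u}" "y \<noteq> v"
  shows "monitors V E v y {v, u}"
  unfolding monitors_def
proof (intro allI impI)
  fix p assume "shortest_path V E v p y"
  then obtain q where "p = v # u # q"
    using path_from_pendant[OF assms(1) _ assms(2)] by (metis shortest_path_def)
  then show "{v, u} \<in> set (walk_edges p)" by simp
qed

lemma leaf_nbrsE:
  assumes "simple_graph V E" "v \<in> leaves V E"
  obtains u where "nbrs E v = {u}"
  using assms by (auto simp: leaves_def graph_degree_eq_card_nbrs[OF assms(1)] card_1_singleton_iff)

text \<open>No path between two other vertices uses the edge at a leaf. Applied to the smaller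
  graph, this ensures that a neighbour which has become a leaf was selected, so exchanging it for
  the deleted vertex costs nothing.\<close>

lemma leaves_subset_MEG_set:
  assumes "simple_graph V E" "connected_graph V E" "MEG_set V E S"
  shows "leaves V E \<subseteq> S"
proof (rule subsetI, rule ccontr)
  fix v assume v: "v \<in> leaves V E" "v \<notin> S"
  obtain u where u: "nbrs E v = {u}" using leaf_nbrsE[OF assms(1) v(1)] .
  then have "{v, u} \<in> E" by (auto simp: nbrs_def)
  then obtain x y where xy: "x \<in> S" "y \<in> S" "monitors V E x y {v, u}"
    using assms(3) by (auto simp: MEG_set_def)
  then have "x \<in> V" "y \<in> V" using assms(3) by (auto simp: MEG_set_def)
  \<comment> \<open>An actual shortest path is needed, since monitoring would be vacuous without
    one.\<close>
  then obtain p where p: "shortest_path V E x p y"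
    using shortest_path_exists[OF assms(2)] by blast
  then have "{v, u} \<subseteq> set p" using xy(3) walk_edges_subset by (metis monitors_def)
  moreover have "v \<notin> set p"
    using pendant_not_interior[OF u] p xy v by (metis shortest_path_def)
  ultimately show False by simp
qed

text \<open>Among the remaining vertices only \<open>u\<close> changes its degree, so no other
  vertex can become a leaf.\<close>

lemma leaves_delete_pendant:
  assumes "simple_graph V E" "nbrs E v = {u}" "x \<noteq> u"
  shows "x \<in> leaves (V - {v}) {e \<in> E. v \<notin> e} \<Longrightarrow> x \<in> leaves V E"
proof -
  assume x: "x \<in> leaves (V - {v}) {e \<in> E. v \<notin> e}"
  then have "x \<noteq> v" by (auto simp: leaves_def)
  have "{e \<in> E. x \<in> e} = {e \<in> {e \<in> E. v \<notin> e}. x \<in> e}"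
  proof -
    have "v \<notin> e" if e: "e \<in> E" "x \<in> e" for e
    proof
      assume "v \<in> e"
      then have "e = {v, x}"
        using simple_graph_edgeE[OF assms(1) e(1)] e(2) \<open>x \<noteq> v\<close> by blast
      then have "x \<in> nbrs E v" using e by (simp add: nbrs_def)
      then show False using assms by simp
    qed
    then show ?thesis by blast
  qed
  then show ?thesis using x by (simp add: leaves_def graph_degree_def)
qed

text \<open>The excess of the set over the number of leaves does not grow. The inequality is
  additive because subtraction on \<open>nat\<close> truncates.\<close>

lemma MEG_set_add_pendant:
  assumes G: "simple_graph V E" and conn: "connected_graph V E"
    and v: "nbrs E v = {u}"
    and S': "MEG_set (V - {v}) {e \<in> E. v \<notin> e} S'" and ne: "{e \<in> E. v \<notin> e} \<noteq> {}"
  shows "\<exists>S. MEG_set V E S \<and> card S + card (leaves (V - {v}) {e \<in> E. v \<notin> e})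
           \<le> card S' + card (leaves V E)"
proof -
  let ?V = "V - {v}" and ?E = "{e \<in> E. v \<notin> e}"
  have vu: "{v, u} \<in> E" using v by (auto simp: nbrs_def)
  note vu' = simple_graph_edgeD[OF G vu]
  have G': "simple_graph ?V ?E" using G by (rule simple_graph_delete_vertex)
  have conn': "connected_graph ?V ?E" using connected_delete_pendant[OF v conn] vu' by blast
  have S'V: "S' \<subseteq> ?V" using S' by (simp add: MEG_set_def)
  note fin = simple_graph_finite[OF G]
  have finS': "finite S'" using S'V fin by (meson finite_Diff finite_subset)
  define S where "S = insert v (if u \<in> leaves ?V ?E then S' - {u} else S')"
  have SS: "S' - {u} \<subseteq> S" by (auto simp: S_def)
  have vL: "v \<in> leaves V E"
    using vu' v graph_degree_eq_card_nbrs[OF G] by (simp add: leaves_def)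
  have finL: "finite (leaves V E)" "finite (leaves ?V ?E)" using fin by (auto simp: leaves_def)
  have vL': "v \<notin> leaves ?V ?E" by (simp add: leaves_def)
  \<comment> \<open>This supplies a partner for \<open>v\<close> other than \<open>u\<close>, which
    may be dropped: some edge survives, and its monitoring pair consists of two different
    vertices.\<close>
  have other: "\<exists>s\<in>S' - {u}. True"
  proof -
    obtain e where "e \<in> ?E" using ne by blast
    then obtain x y where xy: "x \<in> S'" "y \<in> S'" "monitors ?V ?E x y e"
      using S' unfolding MEG_set_def by blast
    then have "x \<noteq> y" using monitors_neq[OF _ xy(3)] S'V by blast
    then show ?thesis using xy by blast
  qed
  have "MEG_set V E S"
    unfolding MEG_set_def
  proof (intro conjI ballI)
    show "S \<subseteq> V" using S'V vu' by (auto simp: S_def)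
    fix e assume e: "e \<in> E"
    show "\<exists>x\<in>S. \<exists>y\<in>S. monitors V E x y e"
    proof (cases "v \<in> e")
      case True
      then obtain w where w: "e = {v, w}"
        using simple_graph_edgeE[OF G e] by (metis insertE insert_commute singletonD)
      then have "w \<in> nbrs E v" using e by (simp add: nbrs_def)
      then have "e = {v, u}" using w v by simp
      moreover obtain s where "s \<in> S' - {u}" using other by blast
      moreover from this have "s \<in> S" "s \<noteq> v" using S'V by (auto simp: S_def)
      ultimately show ?thesis using monitors_pendant_edge[OF v] by (auto simp: S_def)
    next
      case False
      then obtain x y where xy: "x \<in> S'" "y \<in> S'" "monitors ?V ?E x y e"
        using S' e unfolding MEG_set_def by blast
      have xyv: "x \<noteq> v" "y \<noteq> v" "x \<noteq> y"
        using xy S'V monitors_neq[OF _ xy(3)] by blast+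
      then have m: "monitors V E x y e" "monitors V E y x e"
        using monitors_delete_pendant[OF v] xy(3) monitors_sym by metis+
      \<comment> \<open>At most one member of the pair is \<open>u\<close>, and then
        \<open>v\<close> takes its place.\<close>
      consider "x \<in> S" "y \<in> S" | "x = u" "y \<in> S" | "y = u" "x \<in> S"
        using xy xyv SS by blast
      then show ?thesis
      proof cases
        case 1 then show ?thesis using m by blast
      next
        case 2
        then have "monitors V E v y e" using monitors_move_to_pendant[OF G v] m xyv by blast
        then show ?thesis using 2 by (auto simp: S_def)
      next
        case 3
        then have "monitors V E v x e" using monitors_move_to_pendant[OF G v] m xyv by blast
        then show ?thesis using 3 by (auto simp: S_def)
      qed
    qed
  qed
  moreover have "card S + card (leaves ?V ?E) \<le> card S' + card (leaves V E)"
  proof (cases "u \<in> leaves ?V ?E")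
    case True
    \<comment> \<open>Trading \<open>u\<close> for \<open>v\<close> preserves the size of the set,
      and the same trade turns the leaves of the smaller graph into leaves of the larger
      one.\<close>
    have "u \<in> S'" using leaves_subset_MEG_set[OF G' conn' S'] True by blast
    then have "card S = card S'"
    proof -
      have "v \<notin> S' - {u}" using S'V by blast
      then have "card S = Suc (card (S' - {u}))" using True finS' by (simp add: S_def)
      then show ?thesis using card_Suc_Diff1[OF finS' \<open>u \<in> S'\<close>] by simp
    qed
    moreover have "insert v (leaves ?V ?E - {u}) \<subseteq> leaves V E"
      using leaves_delete_pendant[OF G v] vL by blast
    then have "card (insert v (leaves ?V ?E - {u})) \<le> card (leaves V E)"
      by (rule card_mono[OF finL(1)])
    moreover have "card (insert v (leaves ?V ?E - {u})) = card (leaves ?V ?E)"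
    proof -
      have "v \<notin> leaves ?V ?E - {u}" using vL' by blast
      then have "card (insert v (leaves ?V ?E - {u})) = Suc (card (leaves ?V ?E - {u}))"
        using finL(2) by simp
      then show ?thesis using card_Suc_Diff1[OF finL(2) True] by simp
    qed
    ultimately show ?thesis by simp
  next
    case False
    \<comment> \<open>The set grows by at most one, which is paid for by the additional leaf
      \<open>v\<close>.\<close>
    have "card S \<le> Suc (card S')"
      using False finS' by (simp add: S_def card_insert_if)
    moreover have "insert v (leaves ?V ?E) \<subseteq> leaves V E"
    proof
      fix x assume "x \<in> insert v (leaves ?V ?E)"
      then show "x \<in> leaves V E"
        using leaves_delete_pendant[OF G v, of x] vL False by (cases "x = u") auto
    qed
    then have "card (insert v (leaves ?V ?E)) \<le> card (leaves V E)"
      by (rule card_mono[OF finL(1)])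
    moreover have "card (insert v (leaves ?V ?E)) = Suc (card (leaves ?V ?E))"
      using finL vL' by simp
    ultimately show ?thesis by simp
  qed
  ultimately show ?thesis by blast
qed

section \<open>Graphs levelled by the distance to the branch vertices\<close>

text \<open>An abstraction of the distance to the branch vertices, which all lie on level 0 by
  \<open>degree_2\<close>. As edges are unordered, \<open>edge_level\<close> bounds the difference
  of levels in both directions.\<close>

locale levelled_graph =
  fixes V :: "'a set" and E :: "'a set set" and d :: "'a \<Rightarrow> nat"
  assumes simple: "simple_graph V E"
    and edge_level: "{x, y} \<in> E \<Longrightarrow> d x \<le> Suc (d y)"
    and lower_nbr: "x \<in> V \<Longrightarrow> d x > 0 \<Longrightarrow> \<exists>y. {x, y} \<in> E \<and> d x = Suc (d y)"
    and degree_2: "x \<in> V \<Longrightarrow> d x > 0 \<Longrightarrow> card (nbrs E x) = 2"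
begin

definition feet :: "'a set" where
  "feet = {x \<in> V. d x = 0}"

definition downs :: "'a \<Rightarrow> 'a set" where
  "downs x = {y \<in> nbrs E x. d x = Suc (d y)}"

definition ups :: "'a \<Rightarrow> 'a set" where
  "ups x = {y \<in> nbrs E x. d y = Suc (d x)}"

text \<open>By \<open>degree_2\<close>, a top has two lower neighbours, or one lower neighbour and
  one on its own level.\<close>

definition tops :: "'a set" where
  "tops = {x \<in> V. d x > 0 \<and> ups x = {}}"

text \<open>An edge loses at most one level, so the condition on the length forces every step to go
  down by exactly one; \<open>descending_Cons\<close> turns this into a recursion.\<close>

definition descending :: "'a list \<Rightarrow> bool" where
  "descending p \<longleftrightarrow> graph_walk V E p \<and> d (last p) = 0 \<and> length p = Suc (d (hd p))"

definition forks :: "'a set" where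
  "forks = {m \<in> tops. \<exists>p q. descending p \<and> descending q \<and> hd p = m \<and> hd q = m \<and>
     last p = last q \<and> p \<noteq> q}"

lemma finite_parts: "finite V" "finite E" "finite feet" "finite tops" "finite forks"
  "finite (downs x)" "finite (ups x)"
  using simple_graph_finite[OF simple] finite_nbrs[OF simple, of x]
  by (auto simp: feet_def tops_def forks_def downs_def ups_def)

section \<open>Descending paths\<close>

lemma level_less_walk_length:
  "graph_walk V E p \<Longrightarrow> d (last p) = 0 \<Longrightarrow> d (hd p) < length p"
proof (induction p rule: walk_edges.induct)
  case (3 u v p)
  then show ?case using edge_level[of u v] by (auto simp: graph_walk_Cons)
qed (auto simp: graph_walk_def)

lemma descending_Cons:
  "descending (x # y # p) \<longleftrightarrow> {x, y} \<in> E \<and> d x = Suc (d y) \<and> descending (y # p)"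
  using level_less_walk_length[of "y # p"] edge_level[of x y] simple_graph_edgeD[OF simple, of x y]
  by (auto simp: descending_def graph_walk_Cons)

lemma descending_singleton: "descending [x] \<longleftrightarrow> x \<in> feet"
  by (auto simp: descending_def graph_walk_def feet_def)

lemma descending_nonempty: "\<not> descending []"
  by (simp add: descending_def graph_walk_def)

lemma descending_last: "descending p \<Longrightarrow> last p \<in> feet"
  by (cases p) (auto simp: descending_def graph_walk_def feet_def split: if_splits)

lemma descending_distinct: "descending p \<Longrightarrow> distinct p \<and> (\<forall>z\<in>set p. d z \<le> d (hd p))"
proof (induction p rule: walk_edges.induct)
  case (3 u v p)
  then have "distinct (v # p)" "\<forall>z\<in>set (v # p). d z \<le> d v" "d u = Suc (d v)"
    by (auto simp: descending_Cons)
  then show ?case by fastforce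
qed auto

lemma descending_path: "descending p \<Longrightarrow> path_between V E (hd p) p (last p)"
  using descending_distinct by (auto simp: path_between_def descending_def)

lemma descending_exists: "x \<in> V \<Longrightarrow> \<exists>p. descending (x # p)"
proof (induction "d x" arbitrary: x)
  case 0
  then show ?case using descending_singleton[of x] by (auto simp: feet_def)
next
  case (Suc n)
  then obtain y where y: "{x, y} \<in> E" "d x = Suc (d y)" using lower_nbr[of x] by auto
  then obtain p where "descending (y # p)"
    using Suc simple_graph_edgeD[OF simple y(1)] by (metis nat.inject)
  then show ?case using y descending_Cons by blast
qed

text \<open>Upper neighbours are prepended until a top is reached. Descending paths are distinct, so
  \<open>card V\<close> bounds their length.\<close>

lemma descending_extend_to_top:
  "descending p \<Longrightarrow> d (hd p) > 0 \<Longrightarrow> \<exists>q. descending (q @ p) \<and> hd (q @ p) \<in> tops"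
proof (induction "card V - length p" arbitrary: p rule: less_induct)
  case less
  obtain x p' where p: "p = x # p'" using less.prems descending_nonempty by (cases p) auto
  have sub: "set p \<subseteq> V" using less.prems by (simp add: descending_def graph_walk_def)
  show ?case
  proof (cases "x \<in> tops")
    case True
    then show ?thesis using less.prems p by (intro exI[of _ "[]"]) simp
  next
    case False
    then obtain z where "z \<in> ups x"
      using less.prems p sub by (auto simp: tops_def)
    then have z: "{z, x} \<in> E" "d z = Suc (d x)"
      by (auto simp: ups_def nbrs_def insert_commute)
    then have desc: "descending (z # p)" using less.prems p by (simp add: descending_Cons)
    then have "distinct (z # p)" "set (z # p) \<subseteq> V"
      using descending_distinct[OF desc] desc by (simp_all add: descending_def graph_walk_def)
    then have "length (z # p) \<le> card V"
      using finite_parts(1) by (metis card_mono distinct_card)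
    then have "card V - length (z # p) < card V - length p" by simp
    then obtain q where "descending (q @ z # p)" "hd (q @ z # p) \<in> tops"
      using less.hyps[OF _ desc] z by auto
    then show ?thesis by (intro exI[of _ "q @ [z]"]) simp
  qed
qed

section \<open>Lower and upper neighbours\<close>

lemma card_downs_pos: "x \<in> V \<Longrightarrow> d x > 0 \<Longrightarrow> card (downs x) \<ge> 1"
  using lower_nbr[of x] finite_parts(6)[of x]
  by (fastforce simp: downs_def nbrs_def Suc_le_eq card_gt_0_iff)

lemma card_downs_ups_le: "card (downs x) + card (ups x) \<le> card (nbrs E x)"
proof -
  have "card (downs x) + card (ups x) = card (downs x \<union> ups x)"
    using finite_parts(6,7) by (subst card_Un_disjoint) (auto simp: downs_def ups_def)
  also have "\<dots> \<le> card (nbrs E x)"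
    using finite_nbrs[OF simple] by (intro card_mono) (auto simp: downs_def ups_def)
  finally show ?thesis .
qed

lemma card_ups_pos: "x \<in> V \<Longrightarrow> d x > 0 \<Longrightarrow> x \<notin> tops \<Longrightarrow> card (ups x) \<ge> 1"
  using finite_parts(7)[of x] by (auto simp: tops_def Suc_le_eq card_gt_0_iff)

text \<open>One of the two neighbours is lower and, away from the tops, one is upper. Hence
  descending paths cannot branch at such a vertex.\<close>

lemma non_top_card:
  assumes "x \<in> V" "d x > 0" "x \<notin> tops"
  shows "card (downs x) = 1" "card (ups x) = 1"
  using card_downs_pos[OF assms(1,2)] card_ups_pos[OF assms] card_downs_ups_le[of x]
    degree_2[OF assms(1,2)] by auto

lemma below_not_top: "{x, y} \<in> E \<Longrightarrow> d x = Suc (d y) \<Longrightarrow> y \<notin> tops"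
  by (auto simp: tops_def ups_def nbrs_def insert_commute)

text \<open>The only choice is at the head: every later vertex lies below another one, hence is no
  top and has at most one lower neighbour. The premise on \<open>downs\<close> is conditional
  because a foot has no lower neighbour.\<close>

lemma descending_unique:
  assumes "descending p" "descending q" "hd p = hd q" "d (hd p) > 0 \<Longrightarrow> card (downs (hd p)) = 1"
  shows "p = q"
  using assms
proof (induction p arbitrary: q rule: walk_edges.induct)
  case 1
  then show ?case by (simp add: descending_nonempty)
next
  case (2 v)
  then show ?case
    by (cases q rule: walk_edges.cases)
      (auto simp: descending_nonempty descending_singleton descending_Cons feet_def)
next
  case (3 u v p)
  then have uv: "{u, v} \<in> E" "d u = Suc (d v)" "descending (v # p)"
    by (auto simp: descending_Cons)
  obtain w q' where q: "q = u # w # q'"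
    using "3.prems" uv by (cases q rule: walk_edges.cases)
      (auto simp: descending_nonempty descending_singleton feet_def)
  then have uw: "{u, w} \<in> E" "d u = Suc (d w)" "descending (w # q')"
    using "3.prems" by (auto simp: descending_Cons)
  have "card (downs u) = 1" using "3.prems"(4) uv by simp
  moreover have "v \<in> downs u" "w \<in> downs u" using uv uw by (auto simp: downs_def nbrs_def)
  ultimately have "v = w" by (metis card_1_singletonE singletonD)
  moreover have "card (downs v) = 1" if "d v > 0"
    using non_top_card(1) that below_not_top[OF uv(1,2)] simple_graph_edgeD[OF simple uv(1)] by blast
  ultimately show ?case using "3.IH"[of "w # q'"] uv uw q by simp
qed

text \<open>Even if the first vertex has two lower neighbours, the rest of the path is determined by
  where it starts. This is what makes the neighbours of a fork useful.\<close>

lemma descending_below_unique: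
  assumes "descending (x # p)" "descending q" "p \<noteq> []" "hd p = hd q"
  shows "p = q"
proof -
  obtain y p' where p: "p = y # p'" using assms by (cases p) auto
  then have y: "{x, y} \<in> E" "d x = Suc (d y)" "descending p"
    using assms by (auto simp: descending_Cons)
  have "card (downs y) = 1" if "d y > 0"
    using non_top_card(1) that below_not_top[OF y(1,2)] simple_graph_edgeD[OF simple y(1)] by blast
  then show ?thesis using descending_unique[OF y(3) assms(2,4)] p by simp
qed

section \<open>The monitoring set\<close>

lemma unique_descending_monitors:
  assumes "descending p" "e \<in> set (walk_edges p)"
    and uniq: "\<And>q. descending q \<Longrightarrow> hd q = hd p \<Longrightarrow> last q = last p \<Longrightarrow> q = p"
  shows "monitors V E (hd p) (last p) e"
  unfolding monitors_def
proof (intro allI impI)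
  fix q assume q: "shortest_path V E (hd p) q (last p)"
  then have "length q \<le> length p"
    using descending_path[OF assms(1)] unfolding shortest_path_def by blast
  moreover have q': "graph_walk V E q" "hd q = hd p" "last q = last p"
    using q by (auto simp: shortest_path_def path_between_def)
  \<comment> \<open>No walk from the head to level 0 is shorter than a descending one, so a path
    that is no longer is itself descending.\<close>
  ultimately have "descending q"
    using assms(1) level_less_walk_length[of q] by (auto simp: descending_def)
  then show "e \<in> set (walk_edges q)" using uniq q' assms(2) by blast
qed

text \<open>The neighbours of a fork are included because the fork and its foot are joined by two
  shortest paths and so need not monitor the edges on them.\<close>

definition monitor_set :: "'a set" where
  "monitor_set = feet \<union> tops \<union> (\<Union>m\<in>forks. nbrs E m)"

text \<open>The edge is extended downwards to a foot and upwards to a top. If no other descending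
  path joins these two, they monitor the edge; otherwise the top is a fork.\<close>

lemma descending_edge_monitored:
  assumes "{x, y} \<in> E" "d x = Suc (d y)"
  shows "\<exists>a\<in>monitor_set. \<exists>b\<in>monitor_set. monitors V E a b {x, y}"
proof -
  obtain r where "descending (y # r)"
    using descending_exists simple_graph_edgeD[OF simple assms(1)] by blast
  then have "descending (x # y # r)" using assms by (simp add: descending_Cons)
  then obtain q where p: "descending (q @ x # y # r)" "hd (q @ x # y # r) \<in> tops"
    using descending_extend_to_top[of "x # y # r"] assms by auto
  define p where "p = q @ x # y # r"
  note p = p[folded p_def]
  have e: "{x, y} \<in> set (walk_edges p)" unfolding p_def by (rule set_walk_edges_appendI) simp
  have "length p \<ge> 2" by (simp add: p_def)
  then obtain m n s where ms: "p = m # n # s" by (cases p rule: walk_edges.cases) auto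
  have foot: "last p \<in> monitor_set" using descending_last[OF p(1)] by (simp add: monitor_set_def)
  show ?thesis
  proof (cases "\<forall>q. descending q \<longrightarrow> hd q = hd p \<longrightarrow> last q = last p \<longrightarrow> q = p")
    case True
    then have "monitors V E (hd p) (last p) {x, y}"
      using unique_descending_monitors[OF p(1) e] by blast
    then show ?thesis using p foot by (auto simp: monitor_set_def)
  next
    case False
    then have m: "m \<in> forks" using p ms unfolding forks_def by fastforce
    have mn: "{m, n} \<in> E" using p ms by (simp add: descending_Cons)
    have S: "m \<in> monitor_set" "n \<in> monitor_set"
      using m mn by (auto simp: monitor_set_def forks_def nbrs_def)
    show ?thesis
    \<comment> \<open>The first edge is monitored by its own ends, every later one by
      \<open>n\<close> and the foot.\<close>
    proof (cases "{x, y} = {m, n}")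
      case True
      then show ?thesis using monitors_edge[OF simple mn] S by auto
    next
      case False
      then have "{x, y} \<in> set (walk_edges (n # s))" using e ms by simp
      moreover have "descending (n # s)" using p(1) ms by (simp add: descending_Cons)
      moreover have "q = n # s" if "descending q" "hd q = hd (n # s)" for q
        using descending_below_unique[of m "n # s" q] p(1) ms that by simp
      ultimately have "monitors V E (hd (n # s)) (last (n # s)) {x, y}"
        by (intro unique_descending_monitors)
      then have "monitors V E n (last p) {x, y}" using ms by simp
      then show ?thesis using S foot by blast
    qed
  qed
qed

text \<open>A vertex of positive level that is no top already has one lower and one upper neighbour,
  which leaves no room for a third.\<close>

lemma horizontal_edge_top:
  assumes "{x, y} \<in> E" "d x = d y" "d x > 0"
  shows "x \<in> tops"
proof (rule ccontr)
  assume "x \<notin> tops"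
  have x: "x \<in> V" using simple_graph_edgeD[OF simple assms(1)] by blast
  then have c: "card (downs x) = 1" "card (ups x) = 1" using non_top_card \<open>x \<notin> tops\<close> assms by auto
  have "card (insert y (downs x \<union> ups x)) \<le> card (nbrs E x)"
    using assms finite_nbrs[OF simple] by (intro card_mono) (auto simp: nbrs_def downs_def ups_def)
  moreover have "card (insert y (downs x \<union> ups x)) = Suc (card (downs x \<union> ups x))"
  proof (rule card_insert_disjoint)
    show "y \<notin> downs x \<union> ups x" using assms by (simp add: downs_def ups_def)
  qed (simp add: finite_parts)
  moreover have "card (downs x \<union> ups x) = 2"
  proof -
    have "downs x \<inter> ups x = {}" by (auto simp: downs_def ups_def)
    then show ?thesis using card_Un_disjoint[OF finite_parts(6,7)] c by simp
  qed
  ultimately show False using degree_2[OF x assms(3)] by simp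
qed

lemma MEG_set_monitor_set: "MEG_set V E monitor_set"
  unfolding MEG_set_def
proof (intro conjI ballI)
  show "monitor_set \<subseteq> V"
    using nbrs_subset[OF simple] by (auto simp: monitor_set_def feet_def tops_def)
  fix e assume e: "e \<in> E"
  then obtain x y where xy: "e = {x, y}" "x \<in> V" "y \<in> V"
    using simple_graph_edgeE[OF simple] by metis
  have xyE: "{x, y} \<in> E" "{y, x} \<in> E" using e xy by (auto simp: insert_commute)
  have "d x \<le> Suc (d y)" "d y \<le> Suc (d x)" using edge_level xyE by auto
  then consider "d x = Suc (d y)" | "d y = Suc (d x)" | "d x = d y" by linarith
  then show "\<exists>a\<in>monitor_set. \<exists>b\<in>monitor_set. monitors V E a b e"
  proof cases
    case 1
    then show ?thesis using descending_edge_monitored xyE xy by blast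
  next
    case 2
    then show ?thesis using descending_edge_monitored[OF xyE(2)] xy by (simp add: insert_commute)
  next
    case 3
    \<comment> \<open>On level 0 both ends are feet, on any higher level both are tops.\<close>
    then have "x \<in> monitor_set" "y \<in> monitor_set"
      using xy horizontal_edge_top[OF xyE(1)] horizontal_edge_top[OF xyE(2)]
      by (auto simp: monitor_set_def feet_def)
    then show ?thesis using monitors_edge[OF simple xyE(1)] xy by blast
  qed
qed

section \<open>Counting tops and forks\<close>

lemma sum_downs_eq_sum_ups: "(\<Sum>x\<in>V. card (downs x)) = (\<Sum>x\<in>V. card (ups x))"
proof -
  let ?R = "\<lambda>x y. {x, y} \<in> E \<and> d x = Suc (d y)"
  have "downs x = {y \<in> V. ?R x y}" "ups x = {y \<in> V. ?R y x}" for x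
    using simple_graph_edgeD[OF simple]
    by (auto simp: downs_def ups_def nbrs_def insert_commute)
  \<comment> \<open>Both sums count the edges between consecutive levels, once at the upper and once
    at the lower end.\<close>
  then show ?thesis
    using sum_multicount_gen[OF finite_parts(1,1), of ?R "\<lambda>x. card (ups x)"] by simp
qed

text \<open>In the two counts the vertices in \<open>mid\<close> contribute 1 to either side and
  cancel, while tops have no upper neighbours.\<close>

lemma sum_downs_tops_le: "(\<Sum>x\<in>tops. card (downs x)) \<le> (\<Sum>x\<in>feet. card (nbrs E x))"
proof -
  define mid where "mid = {x \<in> V. d x > 0 \<and> x \<notin> tops}"
  have V: "V = feet \<union> (tops \<union> mid)" by (auto simp: feet_def tops_def mid_def)
  have disj: "feet \<inter> (tops \<union> mid) = {}" "tops \<inter> mid = {}" "finite mid"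
    using finite_parts(1) by (auto simp: feet_def tops_def mid_def)
  have split: "(\<Sum>x\<in>V. f x) = (\<Sum>x\<in>feet. f x) + ((\<Sum>x\<in>tops. f x) + (\<Sum>x\<in>mid. f x))"
    for f :: "'a \<Rightarrow> nat"
    using disj finite_parts by (subst V) (simp add: sum.union_disjoint)
  have "(\<Sum>x\<in>mid. card (downs x)) = (\<Sum>x\<in>mid. card (ups x))"
    by (rule sum.cong) (auto simp: mid_def non_top_card)
  moreover have "(\<Sum>x\<in>tops. card (ups x)) = 0" by (simp add: tops_def)
  ultimately have "(\<Sum>x\<in>tops. card (downs x)) \<le> (\<Sum>x\<in>feet. card (ups x))"
    using sum_downs_eq_sum_ups split[of "\<lambda>x. card (downs x)"] split[of "\<lambda>x. card (ups x)"] by simp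
  also have "\<dots> \<le> (\<Sum>x\<in>feet. card (nbrs E x))"
    using card_downs_ups_le by (intro sum_mono) (meson add_leD2)
  finally show ?thesis .
qed

text \<open>Two different descending paths from \<open>m\<close> part at the very first step, since
  everything after it is determined.\<close>

lemma forkE:
  assumes "m \<in> forks"
  obtains a b p q where "descending (m # a # p)" "descending (m # b # q)" "a \<noteq> b"
    "last (a # p) = last (b # q)"
proof -
  obtain p q where pq: "m \<in> tops" "descending p" "descending q" "hd p = m" "hd q = m"
      "last p = last q" "p \<noteq> q"
    using assms by (auto simp: forks_def)
  then have "d m > 0" by (simp add: tops_def)
  then obtain a p' b q' where p': "p = m # a # p'" and q': "q = m # b # q'"
    using pq by (cases p rule: walk_edges.cases; cases q rule: walk_edges.cases)
      (auto simp: descending_nonempty descending_singleton feet_def)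
  have "a \<noteq> b"
  proof
    assume "a = b"
    then have "a # p' = b # q'"
      using descending_below_unique[of m "a # p'" "b # q'"] pq p' q' by (auto simp: descending_Cons)
    then show False using pq p' q' by simp
  qed
  then show ?thesis using that pq p' q' by auto
qed

lemma card_downs_fork: "m \<in> forks \<Longrightarrow> card (downs m) \<ge> 2"
proof -
  assume "m \<in> forks"
  then obtain a b p q where "descending (m # a # p)" "descending (m # b # q)" "a \<noteq> b"
    by (metis forkE)
  then have "{a, b} \<subseteq> downs m" "card {a, b} = 2"
    by (auto simp: descending_Cons downs_def nbrs_def)
  then show ?thesis using card_mono[OF finite_parts(6)] by metis
qed

text \<open>Every top has a lower neighbour and a fork has two, so forks are counted twice.\<close>

lemma card_tops_forks_le: "card tops + card forks \<le> (\<Sum>x\<in>tops. card (downs x))"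
proof -
  have "forks \<subseteq> tops" by (auto simp: forks_def)
  then have "card forks = (\<Sum>x\<in>tops. if x \<in> forks then 1 else 0)"
    using finite_parts by (simp add: sum.If_cases Int_absorb1)
  then have "card tops + card forks = (\<Sum>x\<in>tops. 1 + (if x \<in> forks then 1 else 0))"
    by (subst sum.distrib) simp
  also have "\<dots> \<le> (\<Sum>x\<in>tops. card (downs x))"
  proof (rule sum_mono)
    fix x assume "x \<in> tops"
    then show "1 + (if x \<in> forks then 1 else 0) \<le> card (downs x)"
      using card_downs_fork[of x] card_downs_pos[of x] by (cases "x \<in> forks") (auto simp: tops_def)
  qed
  finally show ?thesis .
qed

text \<open>Deleting, at every fork, one of its two edges keeps the graph connected, because the two
  descending paths of a fork close up to a cycle.\<close>

lemma card_forks_le: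
  assumes conn: "\<And>x y. x \<in> V \<Longrightarrow> y \<in> V \<Longrightarrow> (x, y) \<in> (adj E)\<^sup>*"
  shows "card forks + card V \<le> card E + 1"
proof -
  have "\<forall>m\<in>forks. \<exists>a. \<exists>b p q. descending (m # a # p) \<and> descending (m # b # q) \<and> a \<noteq> b \<and>
      last (a # p) = last (b # q)"
    by (meson forkE)
  \<comment> \<open>\<open>n m\<close> is the lower end of the edge to be deleted at the fork
    \<open>m\<close>.\<close>
  then obtain n where n: "\<forall>m\<in>forks. \<exists>b p q. descending (m # n m # p) \<and> descending (m # b # q) \<and>
      n m \<noteq> b \<and> last (n m # p) = last (b # q)"
    by (metis (no_types, lifting))
  have nE: "{m, n m} \<in> E" "d m = Suc (d (n m))" if "m \<in> forks" for m
    using n that by (auto simp: descending_Cons)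
  let ?X = "(\<lambda>m. {m, n m}) ` forks"
  let ?E = "E - ?X"
  \<comment> \<open>A fork is recovered from its edge as the end of higher level.\<close>
  have "inj_on (\<lambda>m. {m, n m}) forks"
  proof (rule inj_onI)
    fix m m' assume "m \<in> forks" "m' \<in> forks" "{m, n m} = {m', n m'}"
    then show "m = m'" using nE(2)[of m] nE(2)[of m'] by (auto simp: doubleton_eq_iff)
  qed
  then have cardX: "card ?X = card forks" by (rule card_image)
  have XE: "?X \<subseteq> E" using nE by auto
  have kept: "{x, y} \<notin> ?X" if "d x = Suc (d y)" "x \<in> forks \<Longrightarrow> y \<noteq> n x" for x y
  proof
    assume "{x, y} \<in> ?X"
    then obtain m where "m \<in> forks" "{x, y} = {m, n m}" by blast
    then show False using that nE(2)[of m] by (auto simp: doubleton_eq_iff)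
  qed
  \<comment> \<open>A descending path that does not start at a top meets no top, hence no fork, and
    so avoids all deleted edges.\<close>
  have tail: "set (walk_edges p) \<subseteq> ?E" if "descending p" "hd p \<notin> tops" for p
    using that
  proof (induction p rule: walk_edges.induct)
    case (3 u v p)
    then have uv: "{u, v} \<in> E" "d u = Suc (d v)" "descending (v # p)" "u \<notin> forks"
      by (auto simp: descending_Cons forks_def)
    then show ?case using "3.IH" kept[of u v] below_not_top[OF uv(1,2)] by auto
  qed auto
  \<comment> \<open>The detour takes the kept edge from \<open>m\<close> to \<open>b\<close>,
    descends to the common foot and climbs to \<open>n m\<close>.\<close>
  have cut: "(m, n m) \<in> (adj ?E)\<^sup>*" if m: "m \<in> forks" for m
  proof -
    obtain b p q where *: "descending (m # n m # p)" "descending (m # b # q)"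
        "n m \<noteq> b" "last (n m # p) = last (b # q)"
      using n m by blast
    then have mb: "{m, b} \<in> E" "d m = Suc (d b)" and "descending (n m # p)" "descending (b # q)"
      by (auto simp: descending_Cons)
    then have "set (walk_edges (n m # p)) \<subseteq> ?E" "set (walk_edges (b # q)) \<subseteq> ?E"
      using tail below_not_top[OF nE[OF m]] below_not_top[OF mb] by (metis list.sel(1))+
    then have "(n m, last (n m # p)) \<in> (adj ?E)\<^sup>*" "(b, last (b # q)) \<in> (adj ?E)\<^sup>*"
      using walk_adj_rtrancl[of "n m # p" ?E] walk_adj_rtrancl[of "b # q" ?E] by auto
    then have "(b, n m) \<in> (adj ?E)\<^sup>*"
      using *(4) adj_rtrancl_sym[of "n m" "last (n m # p)"] by (auto intro: rtrancl_trans)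
    moreover have "(m, b) \<in> adj ?E" using kept[of m b] mb *(3) by (auto simp: adj_def)
    ultimately show ?thesis by (rule converse_rtrancl_into_rtrancl[rotated])
  qed
  have bypass: "(x, y) \<in> (adj ?E)\<^sup>*" if xy: "{x, y} \<in> E - ?E" for x y
  proof -
    obtain m where "m \<in> forks" "{x, y} = {m, n m}" using xy by blast
    then show ?thesis using cut[of m] adj_rtrancl_sym[OF cut[of m]] by (auto simp: doubleton_eq_iff)
  qed
  have "(x, y) \<in> (adj ?E)\<^sup>*" if "x \<in> V" "y \<in> V" for x y
    using bypass conn[OF that] by (rule adj_rtrancl_bypass)
  then have "card V \<le> card ?E + 1"
    by (intro connected_card_le simple_graph_mono[OF simple]) auto
  moreover have "card ?E = card E - card forks" "card forks \<le> card E"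
    using XE finite_parts(2,5) cardX card_mono[OF finite_parts(2) XE]
    by (simp_all add: card_Diff_subset)
  ultimately show ?thesis by simp
qed

lemma card_monitor_set_le: "card monitor_set \<le> card feet + card tops + 2 * card forks"
proof -
  have "card (\<Union>m\<in>forks. nbrs E m) \<le> (\<Sum>m\<in>forks. card (nbrs E m))"
    by (rule card_UN_le) (rule finite_parts)
  also have "\<dots> = 2 * card forks"
    using degree_2 by (simp add: forks_def tops_def)
  finally show ?thesis
    unfolding monitor_set_def
    using card_Un_le[of "feet \<union> tops" "\<Union>m\<in>forks. nbrs E m"] card_Un_le[of feet tops] by simp
qed

end

section \<open>The upper bound\<close>

lemma small_MEG_set_min_degree_2:
  fixes V :: "'a set"
  assumes G: "simple_graph V E" and conn: "connected_graph V E"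
    and min: "\<And>x. x \<in> V \<Longrightarrow> graph_degree E x \<ge> 2"
    and r: "card E = card V + r" "r \<ge> 1"
  shows "\<exists>S. MEG_set V E S \<and> card S \<le> 9 * r + 1"
proof -
  note fin = simple_graph_finite[OF G]
  note reach = connected_graph_adj[OF conn]
  define C where "C = {x \<in> V. graph_degree E x \<ge> 3}"
  have finC: "finite C" "C \<subseteq> V" using fin by (auto simp: C_def)
  have "(\<Sum>x\<in>V. graph_degree E x) = (\<Sum>x\<in>C. graph_degree E x) + (\<Sum>x\<in>V - C. graph_degree E x)"
    using finC fin by (metis add.commute sum.subset_diff)
  also have "(\<Sum>x\<in>V - C. graph_degree E x) = (\<Sum>x\<in>V - C. 2)"
    using min by (intro sum.cong) (fastforce simp: C_def)+
  also have "\<dots> = 2 * (card V - card C)" using finC by (simp add: card_Diff_subset)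
  \<comment> \<open>The degree sum is \<open>2 * card E\<close>, and the vertices outside
    \<open>C\<close> contribute 2 each.\<close>
  finally have sumC: "(\<Sum>x\<in>C. graph_degree E x) = 2 * r + 2 * card C"
    using handshake[OF G] r card_mono[OF fin(1) finC(2)] by simp
  have "(\<Sum>x\<in>C. 3) \<le> (\<Sum>x\<in>C. graph_degree E x)"
    by (intro sum_mono) (simp add: C_def)
  then have cardC: "card C \<le> 2 * r" using sumC by simp
  \<comment> \<open>An empty \<open>C\<close> would make the sum 0, against
    \<open>r \<ge> 1\<close>.\<close>
  have "C \<noteq> {}" using sumC r by auto
  then obtain c0 where c0: "c0 \<in> C" by blast
  \<comment> \<open>\<open>Q x n\<close> asks for a walk of exactly \<open>n\<close> steps into
    \<open>C\<close>, so its least \<open>n\<close> is the distance. It exists on \<open>V\<close>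
    because \<open>c0\<close> is reachable.\<close>
  define Q where "Q = (\<lambda>x n. \<exists>c\<in>C. (x, c) \<in> adj E ^^ n)"
  define d where "d x = (LEAST n. Q x n)" for x
  have dI: "d x \<le> n" if "Q x n" for x n unfolding d_def using that by (rule Least_le)
  have Qd: "Q x (d x)" if "x \<in> V" for x
  proof -
    have "(x, c0) \<in> (adj E)\<^sup>*" using reach that c0 finC by blast
    then have "\<exists>n. Q x n" using c0 unfolding Q_def by (meson rtrancl_imp_relpow)
    then show ?thesis unfolding d_def by (rule LeastI_ex)
  qed
  have d0: "d x = 0 \<longleftrightarrow> x \<in> C" if "x \<in> V" for x
  proof
    assume "d x = 0"
    then show "x \<in> C" using Qd[OF that] by (auto simp: Q_def)
  next
    assume "x \<in> C"
    then have "Q x 0" by (auto simp: Q_def)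
    then show "d x = 0" using dI by fastforce
  qed
  interpret levelled_graph V E d
  proof
    show "simple_graph V E" by (rule G)
  next
    fix x y assume e: "{x, y} \<in> E"
    then have "Q y (d y)" using Qd simple_graph_edgeD[OF G e] by blast
    then obtain c where "c \<in> C" "(y, c) \<in> adj E ^^ d y" by (auto simp: Q_def)
    moreover have "(x, y) \<in> adj E" using e by (simp add: adj_def)
    ultimately have "Q x (Suc (d y))" unfolding Q_def by (meson relpow_Suc_I2)
    then show "d x \<le> Suc (d y)" by (rule dI)
  next
    fix x assume x: "x \<in> V" "d x > 0"
    then obtain n where n: "d x = Suc n" using gr0_implies_Suc by blast
    then obtain c where c: "c \<in> C" "(x, c) \<in> adj E ^^ Suc n" using Qd[OF x(1)] by (auto simp: Q_def)
    then obtain y where y: "(x, y) \<in> adj E" "(y, c) \<in> adj E ^^ n" by (meson relpow_Suc_D2)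
    then have e: "{x, y} \<in> E" by (simp add: adj_def)
    have "d y \<le> n" using dI c y by (auto simp: Q_def)
    moreover have "d x \<le> Suc (d y)"
    proof -
      obtain c' where "c' \<in> C" "(y, c') \<in> adj E ^^ d y"
        using Qd simple_graph_edgeD[OF G e] by (auto simp: Q_def)
      then have "Q x (Suc (d y))" using y unfolding Q_def by (meson relpow_Suc_I2)
      then show ?thesis by (rule dI)
    qed
    ultimately show "\<exists>y. {x, y} \<in> E \<and> d x = Suc (d y)" using e n by fastforce
  next
    fix x assume x: "x \<in> V" "d x > 0"
    then have "x \<notin> C" using d0 by force
    then have "graph_degree E x = 2" using min[OF x(1)] x(1) by (simp add: C_def)
    then show "card (nbrs E x) = 2" using graph_degree_eq_card_nbrs[OF G] by simp
  qed
  have feet: "feet = C" using d0 finC by (auto simp: feet_def)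
  have "card tops + card forks \<le> 2 * r + 2 * card C"
    using card_tops_forks_le sum_downs_tops_le sumC feet graph_degree_eq_card_nbrs[OF G]
    by simp
  moreover have "card forks \<le> r + 1" using card_forks_le reach r by simp
  \<comment> \<open>Splitting off one copy of \<open>card forks\<close> gives the bound
    \<open>3 * card C + 2 * r + (r + 1)\<close>, where \<open>card C \<le> 2 * r\<close>.\<close>
  ultimately have "card monitor_set \<le> 9 * r + 1"
    using card_monitor_set_le cardC feet by simp
  then show ?thesis using MEG_set_monitor_set by blast
qed

text \<open>Leaves are stripped one by one. Each takes one vertex and one edge with it, so
  \<open>r\<close> stays fixed throughout the induction.\<close>

lemma small_MEG_set:
  fixes V :: "'a set"
  assumes "simple_graph V E" "connected_graph V E" "card E = card V + r" "r \<ge> 1"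
  shows "\<exists>S. MEG_set V E S \<and> card S \<le> 9 * r + 1 + card (leaves V E)"
  using assms
proof (induction "card V" arbitrary: V E rule: less_induct)
  case less
  note G = less.prems(1) and conn = less.prems(2)
  note fin = simple_graph_finite[OF G]
  \<comment> \<open>A single vertex carries no edge, whereas \<open>card V + r\<close> is
    positive.\<close>
  have two: "\<exists>y\<in>V. y \<noteq> x" for x
  proof (rule ccontr)
    assume "\<not> (\<exists>y\<in>V. y \<noteq> x)"
    then have "E = {}" using simple_graph_edgeE[OF G] by (metis all_not_in_conv)
    then show False using less.prems by simp
  qed
  show ?case
  proof (cases "leaves V E = {}")
    case True
    \<comment> \<open>Connectivity and a second vertex exclude degree 0, the absence of leaves
      excludes degree 1.\<close>
    have "graph_degree E x \<ge> 2" if x: "x \<in> V" for x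
    proof -
      obtain y where y: "y \<in> V" "y \<noteq> x" using two by blast
      then have "(x, y) \<in> (adj E)\<^sup>*" using connected_graph_adj[OF conn x] by blast
      then obtain z where "{x, z} \<in> E"
        using y by (metis adj_def case_prodD converse_rtranclE mem_Collect_eq)
      then have "nbrs E x \<noteq> {}" by (auto simp: nbrs_def)
      then have "card (nbrs E x) \<noteq> 0" using finite_nbrs[OF G] by simp
      moreover have "graph_degree E x \<noteq> 1" using True x by (auto simp: leaves_def)
      ultimately show ?thesis using graph_degree_eq_card_nbrs[OF G, of x] by simp
    qed
    then show ?thesis
      using small_MEG_set_min_degree_2[OF G conn _ less.prems(3,4)] True by auto
  next
    case False
    then obtain v where v: "v \<in> leaves V E" by blast
    then have vV: "v \<in> V" by (simp add: leaves_def)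
    obtain u where u: "nbrs E v = {u}" using leaf_nbrsE[OF G v] .
    let ?V = "V - {v}" and ?E = "{e \<in> E. v \<notin> e}"
    have "E = ?E \<union> {e \<in> E. v \<in> e}" by blast
    then have "card E = card ?E + card {e \<in> E. v \<in> e}"
      using fin by (metis (no_types, lifting) card_Un_disjoint disjoint_iff finite_Un mem_Collect_eq)
    then have cE: "card E = Suc (card ?E)" using v by (simp add: leaves_def graph_degree_def)
    have cV: "card V = Suc (card ?V)" using card_Suc_Diff1[OF fin(1) vV] by simp
    have r': "card ?E = card ?V + r" using cE cV less.prems(3) by simp
    then have ne: "?E \<noteq> {}" using less.prems(4) by force
    have conn': "connected_graph ?V ?E"
      using connected_delete_pendant[OF u conn] two[of v] by blast
    obtain S' where S': "MEG_set ?V ?E S'" "card S' \<le> 9 * r + 1 + card (leaves ?V ?E)"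
      using less.hyps[OF _ simple_graph_delete_vertex[OF G] conn' r' less.prems(4)] cV by auto
    then show ?thesis using MEG_set_add_pendant[OF G conn u S'(1) ne] by fastforce
  qed
qed

theorem theorem8:
  fixes V :: "'a set" and E :: "'a set set"
  assumes "simple_graph V E"
    and "connected_graph V E"
    and "fes V E \<ge> 2"
  shows "int (MEG V E) \<le> 9 * int (fes V E) + int (card (leaves V E)) - 8"
proof -
  have "V \<noteq> {}" using assms(2) by (simp add: connected_graph_def)
  then have "card E + 1 = card V + fes V E"
    using card_edges_le_fes[OF assms(1)] fes_le_card_edges[OF assms(1,2)] by simp
  \<comment> \<open>With \<open>r = fes V E - 1\<close>, the bound \<open>9 * r + 1\<close> equals
    \<open>9 * fes V E - 8\<close>.\<close>
  then have "card E = card V + (fes V E - 1)" "fes V E - 1 \<ge> 1"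
    using assms(3) by auto
  then obtain S where S: "MEG_set V E S" "card S \<le> 9 * (fes V E - 1) + 1 + card (leaves V E)"
    using small_MEG_set[OF assms(1,2)] by blast
  then have "MEG V E \<le> card S" unfolding MEG_def by (intro Least_le) blast
  then show ?thesis using S(2) assms(3) by linarith
qed

end
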